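(* Let $l\ge0$ be an integer, and let $\sigma,\tau,w$ on the open interval $(a,b)$ and the complementary polynomials ${\cal P}_\nu(x;l)$ be as in the context. For every integer $\nu\ge0$ put $$\lambda_{\nu}=-\nu\Big[\Big(l-\frac{\nu+1}{2}\Big)\sigma''+\tau'\Big].$$ Then ${\cal P}_\nu(x;l)$ satisfies on $(a,b)$ the Sturm–Liouville differential equation $$\frac{d}{dx}\left(\sigma(x)^{l-\nu+1}w(x)\frac{d{\cal P}_\nu(x;l)}{dx}\right)=-\lambda_\nu\,\sigma(x)^{l-\nu}w(x)\,{\cal P}_\nu(x;l),$$ which is equivalent to $$\sigma(x)\frac{d^2{\cal P}_\nu(x;l)}{dx^2}+[(l-\nu)\sigma'(x)+\tau(x)]\frac{d{\cal P}_\nu(x;l)}{dx}=-\lambda_\nu\,{\cal P}_\nu(x;l).$$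
   Context: $\sigma(x)=ex^2+2fx+g$ is a real polynomial of degree at most $2$ and $\tau$ is a real polynomial of degree at most $1$; primes denote derivatives in $x$, so $\tau'$ and $\sigma''$ are constants. $(a,b)\subseteq\mathbb R$ is a nonempty open (possibly unbounded) interval containing no zero of $\sigma$, and $w:(a,b)\to\mathbb R$ is a differentiable, nowhere vanishing function satisfying Pearson's equation $\sigma(x)w'(x)=[\tau(x)-\sigma'(x)]w(x)$ on $(a,b)$. The complementary polynomials are defined by ${\cal P}_0(x;l)\equiv1$ and, for $\nu\ge0$, ${\cal P}_{\nu+1}(x;l)=\sigma(x)\frac{d}{dx}{\cal P}_\nu(x;l)+[\tau(x)+(l-\nu-1)\sigma'(x)]{\cal P}_\nu(x;l)$. *)

theory Defs
  imports "HOL-Analysis.Analysis" "HOL-Computational_Algebra.Polynomial"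
begin

primrec complementary_poly :: "real poly \<Rightarrow> real poly \<Rightarrow> nat \<Rightarrow> nat \<Rightarrow> real poly" where
  "complementary_poly \<sigma> \<tau> l 0 = 1"
| "complementary_poly \<sigma> \<tau> l (Suc \<nu>) =
     \<sigma> * pderiv (complementary_poly \<sigma> \<tau> l \<nu>)
     + (\<tau> + smult (real l - real \<nu> - 1) (pderiv \<sigma>)) * complementary_poly \<sigma> \<tau> l \<nu>"

(* For degree \<sigma> \<le> 2 and degree \<tau> \<le> 1 the polynomials \<sigma>'' and \<tau>' are constant;
   their values are read off at 0. *)
definition eigenvalue :: "real poly \<Rightarrow> real poly \<Rightarrow> nat \<Rightarrow> nat \<Rightarrow> real" where
  "eigenvalue \<sigma> \<tau> l \<nu> =
     - real \<nu> * ((real l - (real \<nu> + 1) / 2) * poly (pderiv (pderiv \<sigma>)) 0 + poly (pderiv \<tau>) 0)"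

definition pearson_weight ::
  "real poly \<Rightarrow> real poly \<Rightarrow> real set \<Rightarrow> (real \<Rightarrow> real) \<Rightarrow> bool" where
  "pearson_weight \<sigma> \<tau> I w \<longleftrightarrow>
     (\<forall>x\<in>I. w differentiable (at x) \<and> w x \<noteq> 0 \<and>
        poly \<sigma> x * deriv w x = (poly \<tau> x - poly (pderiv \<sigma>) x) * w x)"

(* The exponents are integers because \<nu> may exceed l. *)
definition sturm_liouville_on ::
  "real poly \<Rightarrow> (real \<Rightarrow> real) \<Rightarrow> nat \<Rightarrow> nat \<Rightarrow> real \<Rightarrow> real set \<Rightarrow> (real \<Rightarrow> real) \<Rightarrow> bool" where
  "sturm_liouville_on \<sigma> w l \<nu> L I y \<longleftrightarrow>
     (\<forall>x\<in>I. ((\<lambda>t. poly \<sigma> t powi (int l - int \<nu> + 1) * w t * deriv y t)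
        has_real_derivative - L * poly \<sigma> x powi (int l - int \<nu>) * w x * y x) (at x))"

definition hypergeometric_ode_on ::
  "real poly \<Rightarrow> real poly \<Rightarrow> nat \<Rightarrow> nat \<Rightarrow> real \<Rightarrow> real set \<Rightarrow> (real \<Rightarrow> real) \<Rightarrow> bool" where
  "hypergeometric_ode_on \<sigma> \<tau> l \<nu> L I y \<longleftrightarrow>
     (\<forall>x\<in>I. poly \<sigma> x * deriv (deriv y) x
        + ((real l - real \<nu>) * poly (pderiv \<sigma>) x + poly \<tau> x) * deriv y x = - L * y x)"

definition twice_differentiable_on_set :: "real set \<Rightarrow> (real \<Rightarrow> real) \<Rightarrow> bool" where
  "twice_differentiable_on_set I y \<longleftrightarrow>
     (\<forall>x\<in>I. y differentiable (at x) \<and> deriv y differentiable (at x))"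

end

theory Submission
  imports Defs
begin

text \<open>
  Write \<open>P\<^sub>\<nu>\<close> for the complementary polynomials and \<open>A\<^sub>\<nu> = \<tau> + (l - \<nu> - 1) \<sigma>'\<close>, so that
  \<open>P\<^sub>\<nu>\<^sub>+\<^sub>1 = \<sigma> P\<^sub>\<nu>' + A\<^sub>\<nu> P\<^sub>\<nu>\<close> and the second-order equation for \<open>P\<^sub>\<nu>\<close> has first-order coefficient
  \<open>A\<^sub>\<nu> + \<sigma>'\<close>. Differentiating the recurrence and using that equation gives
  \<open>P\<^sub>\<nu>\<^sub>+\<^sub>1' = (A\<^sub>\<nu>' - \<lambda>\<^sub>\<nu>) P\<^sub>\<nu> = - \<lambda>\<^sub>\<nu>\<^sub>+\<^sub>1 P\<^sub>\<nu>\<close>. Since \<open>A\<^sub>\<nu>\<^sub>+\<^sub>1 + \<sigma>' = A\<^sub>\<nu>\<close>, applying \<open>\<sigma> d/dx + A\<^sub>\<nu>\<close> to both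
  sides gives the equation for \<open>P\<^sub>\<nu>\<^sub>+\<^sub>1\<close>. Pearson's equation makes \<open>\<sigma>\<^bsup>l-\<nu>\<^esup> w\<close>, which
  has no zeros, an integrating factor; hence the Sturm--Liouville form.
\<close>

lemma pderiv_degree_le_1:
  fixes p :: "real poly"
  assumes "degree p \<le> 1"
  shows "pderiv p = [:poly (pderiv p) 0:]"
proof -
  have "degree (pderiv p) = 0"
    using assms by (simp add: degree_pderiv)
  then show ?thesis
    by (metis degree_eq_zeroE poly_pCons mult_zero_left add_0_right)
qed

text \<open>The decrement is the constant value of \<open>A'\<close> for
  \<open>A = \<tau> + (l - \<nu> - 1) \<sigma>'\<close>, the factor in the recurrence; this drives
  the induction on \<nu>.\<close>

lemma eigenvalue_Suc:
  "eigenvalue \<sigma> \<tau> l (Suc \<nu>) = eigenvalue \<sigma> \<tau> l \<nu> - poly (pderiv \<tau>) 0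
     - (real l - real \<nu> - 1) * poly (pderiv (pderiv \<sigma>)) 0"
  by (simp add: eigenvalue_def field_simps)

lemma complementary_poly_ode:
  fixes \<sigma> \<tau> :: "real poly" and l \<nu> :: nat
  assumes "degree \<sigma> \<le> 2" and "degree \<tau> \<le> 1"
  defines "P \<equiv> complementary_poly \<sigma> \<tau> l"
  shows "\<sigma> * pderiv (pderiv (P \<nu>)) + (smult (real l - real \<nu>) (pderiv \<sigma>) + \<tau>) * pderiv (P \<nu>)
           = smult (- eigenvalue \<sigma> \<tau> l \<nu>) (P \<nu>)"
proof (induction \<nu>)
  case 0
  then show ?case
    by (simp add: P_def eigenvalue_def)
next
  case (Suc \<nu>)
  define A where "A = \<tau> + smult (real l - real \<nu> - 1) (pderiv \<sigma>)"
  have rec: "P (Suc \<nu>) = \<sigma> * pderiv (P \<nu>) + A * P \<nu>"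
    by (simp add: P_def A_def)
  \<comment> \<open>The degree bounds make \<open>\<sigma>''\<close> and \<open>\<tau>'\<close>
    constant, so \<open>pderiv A\<close> acts as a scalar.\<close>
  have "degree (pderiv \<sigma>) \<le> 1"
    using assms(1) by (simp add: degree_pderiv)
  then obtain s where s: "pderiv (pderiv \<sigma>) = [:s:]"
    using pderiv_degree_le_1 by blast
  obtain t where t: "pderiv \<tau> = [:t:]"
    using pderiv_degree_le_1[OF assms(2)] by blast
  have A': "pderiv A = [:eigenvalue \<sigma> \<tau> l \<nu> - eigenvalue \<sigma> \<tau> l (Suc \<nu>):]"
    by (simp add: A_def pderiv_add pderiv_smult eigenvalue_Suc s t)
  have A_shift: "smult (real l - real \<nu>) (pderiv \<sigma>) + \<tau> = A + pderiv \<sigma>"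
    by (simp add: A_def smult_diff_left)
  have "pderiv (P (Suc \<nu>)) =
      (\<sigma> * pderiv (pderiv (P \<nu>)) + (A + pderiv \<sigma>) * pderiv (P \<nu>)) + pderiv A * P \<nu>"
    by (simp add: rec pderiv_add pderiv_mult algebra_simps)
  also have "\<dots> = smult (- eigenvalue \<sigma> \<tau> l (Suc \<nu>)) (P \<nu>)"
    unfolding Suc.IH[unfolded A_shift] A' by (simp add: smult_diff_left)
  finally have P': "pderiv (P (Suc \<nu>)) = smult (- eigenvalue \<sigma> \<tau> l (Suc \<nu>)) (P \<nu>)" .
  have A_Suc: "smult (real l - real (Suc \<nu>)) (pderiv \<sigma>) + \<tau> = A"
    by (simp add: A_def algebra_simps smult_add_left)
  show ?case
    unfolding A_Suc P' pderiv_smult unfolding rec by (simp add: smult_add_right)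
qed

lemma deriv_poly: "deriv (poly p) = poly (pderiv p)" for p :: "real poly"
  by (intro ext DERIV_imp_deriv poly_DERIV)

lemma twice_differentiable_on_set_poly: "twice_differentiable_on_set I (poly p)"
  unfolding twice_differentiable_on_set_def deriv_poly
  using poly_DERIV real_differentiable_def by blast

lemma hypergeometric_ode_on_complementary_poly:
  assumes "degree \<sigma> \<le> 2" and "degree \<tau> \<le> 1"
  shows "hypergeometric_ode_on \<sigma> \<tau> l \<nu> (eigenvalue \<sigma> \<tau> l \<nu>) I
           (poly (complementary_poly \<sigma> \<tau> l \<nu>))"
  unfolding hypergeometric_ode_on_def deriv_poly
  using arg_cong[OF complementary_poly_ode[OF assms, of l \<nu>], of poly]
  by (simp add: fun_eq_iff)

text \<open>The power contributes \<open>(k + 1) \<sigma>'\<close> and Pearson's equation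
  \<open>\<tau> - \<sigma>'\<close> to the coefficient of \<open>y'\<close>, leaving
  \<open>k \<sigma>' + \<tau>\<close>.\<close>

lemma sturm_liouville_derivative:
  fixes y w :: "real \<Rightarrow> real" and k :: int
  assumes "poly \<sigma> x \<noteq> 0"
    and w: "w differentiable (at x)"
    and pearson: "poly \<sigma> x * deriv w x = (poly \<tau> x - poly (pderiv \<sigma>) x) * w x"
    and y': "deriv y differentiable (at x)"
  shows "((\<lambda>t. poly \<sigma> t powi (k + 1) * w t * deriv y t) has_real_derivative
           poly \<sigma> x powi k * w x * (poly \<sigma> x * deriv (deriv y) x
             + (of_int k * poly (pderiv \<sigma>) x + poly \<tau> x) * deriv y x)) (at x)"
proof -
  have "(w has_real_derivative deriv w x) (at x)"
    and "(deriv y has_real_derivative deriv (deriv y) x) (at x)"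
    using w y' by (auto simp: DERIV_deriv_iff_real_differentiable)
  note [derivative_intros] = this poly_DERIV
  \<comment> \<open>One factor \<sigma> is split off the power in the middle term, so that the left
    side of \<open>pearson\<close> appears literally.\<close>
  have "((\<lambda>t. poly \<sigma> t powi (k + 1) * w t * deriv y t) has_real_derivative
      of_int (k + 1) * poly \<sigma> x powi k * poly (pderiv \<sigma>) x * w x * deriv y x
      + poly \<sigma> x powi k * (poly \<sigma> x * deriv w x) * deriv y x
      + poly \<sigma> x powi k * poly \<sigma> x * w x * deriv (deriv y) x) (at x)"
    using assms(1)
    by (auto intro!: derivative_eq_intros simp: power_int_add algebra_simps)
  then show ?thesis
    unfolding pearson by (simp add: algebra_simps)
qed

lemma sturm_liouville_on_iff_hypergeometric_ode_on:
  assumes "\<forall>x\<in>I. poly \<sigma> x \<noteq> 0" and "pearson_weight \<sigma> \<tau> I w"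
    and "twice_differentiable_on_set I y"
  shows "sturm_liouville_on \<sigma> w l \<nu> L I y \<longleftrightarrow> hypergeometric_ode_on \<sigma> \<tau> l \<nu> L I y"
  unfolding sturm_liouville_on_def hypergeometric_ode_on_def
proof (intro ball_cong refl)
  fix x assume x: "x \<in> I"
  define D where "D = poly \<sigma> x * deriv (deriv y) x
    + ((real l - real \<nu>) * poly (pderiv \<sigma>) x + poly \<tau> x) * deriv y x"
  define c where "c = poly \<sigma> x powi (int l - int \<nu>) * w x"
  let ?F = "\<lambda>t. poly \<sigma> t powi (int l - int \<nu> + 1) * w t * deriv y t"
  have "(?F has_real_derivative c * D) (at x)"
    using sturm_liouville_derivative[of \<sigma> x w \<tau> y "int l - int \<nu>"] assms x
    by (simp add: c_def D_def pearson_weight_def twice_differentiable_on_set_def)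
  \<comment> \<open>Uniqueness of derivatives reduces the claim to an equation between numbers, from
    which the nonzero \<open>c\<close> cancels.\<close>
  then have "(?F has_real_derivative E) (at x) \<longleftrightarrow> E = c * D" for E
    by (metis DERIV_unique)
  moreover have "c \<noteq> 0"
    using assms x by (simp add: c_def pearson_weight_def)
  moreover have "- L * poly \<sigma> x powi (int l - int \<nu>) * w x * y x = c * (- L * y x)"
    by (simp add: c_def)
  ultimately show "(?F has_real_derivative
      - L * poly \<sigma> x powi (int l - int \<nu>) * w x * y x) (at x) \<longleftrightarrow>
    poly \<sigma> x * deriv (deriv y) x
      + ((real l - real \<nu>) * poly (pderiv \<sigma>) x + poly \<tau> x) * deriv y x = - L * y x"
    unfolding D_def[symmetric] by (metis mult_cancel_left)
qed

theorem theorem6: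
  fixes \<sigma> \<tau> :: "real poly" and w :: "real \<Rightarrow> real" and a b :: ereal and l \<nu> :: nat
  assumes "degree \<sigma> \<le> 2" and "degree \<tau> \<le> 1"
    and "a < b"
    and "\<forall>x\<in>einterval a b. poly \<sigma> x \<noteq> 0"
    and "pearson_weight \<sigma> \<tau> (einterval a b) w"
  shows "sturm_liouville_on \<sigma> w l \<nu> (eigenvalue \<sigma> \<tau> l \<nu>) (einterval a b)
           (poly (complementary_poly \<sigma> \<tau> l \<nu>))
       \<and> hypergeometric_ode_on \<sigma> \<tau> l \<nu> (eigenvalue \<sigma> \<tau> l \<nu>) (einterval a b)
           (poly (complementary_poly \<sigma> \<tau> l \<nu>))
       \<and> (\<forall>y. twice_differentiable_on_set (einterval a b) y \<longrightarrow>
           (sturm_liouville_on \<sigma> w l \<nu> (eigenvalue \<sigma> \<tau> l \<nu>) (einterval a b) y \<longleftrightarrow>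
            hypergeometric_ode_on \<sigma> \<tau> l \<nu> (eigenvalue \<sigma> \<tau> l \<nu>) (einterval a b) y))"
  \<comment> \<open>The first conjunct is the equivalence read backwards at the complementary
    polynomial.\<close>
  using assms hypergeometric_ode_on_complementary_poly
    sturm_liouville_on_iff_hypergeometric_ode_on twice_differentiable_on_set_poly
  by blast

end
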